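(* For every constant $c>0$ there exist constants $C,d>0$ and $n_0$ such that for every $n\ge n_0$ and every $f:\{0,1\}^n\to\{0,1\}$ that depends on all of its $n$ input variables and satisfies $\mathsf{alt}(f)\le(\log_2 n)^c$, we have $$\mathsf{CC}_\oplus(f)\le C\,(1+\log_2\mathsf{sparsity}(f))^d,$$ i.e. the XOR Log-Rank Conjecture holds for such $f$.
   Context: $\mathsf{alt}(f)$ (alternation): for $x\prec y$ meaning $x_i\le y_i$ for all $i$, a chain is a sequence of distinct inputs $0^n=x_0\prec\dots\prec x_n=1^n$; $\mathsf{alt}(f)$ is the maximum over chains of the number of $i$ with $f(x_{i-1})\ne f(x_i)$. $\mathsf{CC}_\oplus(f)$ is the deterministic two-party communication complexity of $F(x,y)=f(x\oplus y)$, where Alice holds $x\in\{0,1\}^n$ and Bob holds $y\in\{0,1\}^n$. $\mathsf{sparsity}(f)$ is the number of nonzero Fourier coefficients of $1-2f$ (Fourier expansion in the characters $\chi_S(x)=(-1)^{\sum_{i\in S}x_i}$). The XOR Log-Rank Conjecture asserts $\mathsf{CC}_\oplus(f)$ is bounded by a polynomial in $\log\mathsf{sparsity}(f)$. *)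

theory Defs
  imports Complex_Main
begin

text \<open>
  The dimension \<open>n\<close> is quantified inside the statement, so a Boolean function on
  \<open>{0,1}\<^sup>n\<close> is a predicate \<open>f :: bool list \<Rightarrow> bool\<close> together with \<open>n\<close>; every notion
  below only looks at \<open>f\<close> on lists of length \<open>n\<close>.  Coordinates are numbered \<open>0, \<dots>, n - 1\<close>.
\<close>

definition cube :: "nat \<Rightarrow> bool list set" where
  "cube n = {x. length x = n}"

definition bxor :: "bool list \<Rightarrow> bool list \<Rightarrow> bool list" where
  "bxor x y = map2 (\<noteq>) x y"

definition depends_on_all :: "nat \<Rightarrow> (bool list \<Rightarrow> bool) \<Rightarrow> bool" where
  "depends_on_all n f \<longleftrightarrow> (\<forall>i<n. \<exists>x\<in>cube n. f (x[i := \<not> x ! i]) \<noteq> f x)"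


definition preceq :: "bool list \<Rightarrow> bool list \<Rightarrow> bool" where
  "preceq x y \<longleftrightarrow> list_all2 (\<le>) x y"

definition cube_chain :: "nat \<Rightarrow> (nat \<Rightarrow> bool list) \<Rightarrow> bool" where
  "cube_chain n c \<longleftrightarrow>
     (\<forall>i\<le>n. c i \<in> cube n) \<and> inj_on c {0..n} \<and>
     c 0 = replicate n False \<and> c n = replicate n True \<and>
     (\<forall>i\<in>{1..n}. preceq (c (i - 1)) (c i))"

definition alternation :: "nat \<Rightarrow> (bool list \<Rightarrow> bool) \<Rightarrow> nat" where
  "alternation n f =
     Max {card {i\<in>{1..n}. f (c (i - 1)) \<noteq> f (c i)} | c. cube_chain n c}"


definition character :: "nat set \<Rightarrow> bool list \<Rightarrow> real" where
  "character S x = (- 1) ^ (\<Sum>i\<in>S. of_bool (x ! i))"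

definition fourier_coeff :: "nat \<Rightarrow> (bool list \<Rightarrow> real) \<Rightarrow> nat set \<Rightarrow> real" where
  "fourier_coeff n g S = (\<Sum>x\<in>cube n. g x * character S x) / 2 ^ n"

definition sparsity :: "nat \<Rightarrow> (bool list \<Rightarrow> bool) \<Rightarrow> nat" where
  "sparsity n f =
     card {S. S \<subseteq> {..<n} \<and> fourier_coeff n (\<lambda>x. 1 - 2 * of_bool (f x)) S \<noteq> 0}"


text \<open>
  A deterministic two-party protocol is a binary tree: at an inner node its owner sends one bit,
  a function of the owner's input, which selects the left (bit \<open>False\<close>) or right (bit \<open>True\<close>)
  subtree; leaves carry the output, so both players know it at the end.
\<close>

datatype ('a, 'b) protocol =
    Output bool
  | Alice "'a \<Rightarrow> bool" "('a, 'b) protocol" "('a, 'b) protocol"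
  | Bob "'b \<Rightarrow> bool" "('a, 'b) protocol" "('a, 'b) protocol"

primrec run :: "('a, 'b) protocol \<Rightarrow> 'a \<Rightarrow> 'b \<Rightarrow> bool" where
  "run (Output b) x y = b"
| "run (Alice m P Q) x y = (if m x then run Q x y else run P x y)"
| "run (Bob m P Q) x y = (if m y then run Q x y else run P x y)"

primrec cost :: "('a, 'b) protocol \<Rightarrow> nat" where
  "cost (Output b) = 0"
| "cost (Alice m P Q) = Suc (max (cost P) (cost Q))"
| "cost (Bob m P Q) = Suc (max (cost P) (cost Q))"

definition computes ::
    "'a set \<Rightarrow> 'b set \<Rightarrow> ('a \<Rightarrow> 'b \<Rightarrow> bool) \<Rightarrow> ('a, 'b) protocol \<Rightarrow> bool" where
  "computes X Y F P \<longleftrightarrow> (\<forall>x\<in>X. \<forall>y\<in>Y. run P x y = F x y)"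

definition det_cc :: "'a set \<Rightarrow> 'b set \<Rightarrow> ('a \<Rightarrow> 'b \<Rightarrow> bool) \<Rightarrow> nat" where
  "det_cc X Y F = (LEAST k. \<exists>P. computes X Y F P \<and> cost P = k)"

definition cc_xor :: "nat \<Rightarrow> (bool list \<Rightarrow> bool) \<Rightarrow> nat" where
  "cc_xor n f = det_cc (cube n) (cube n) (\<lambda>x y. f (bxor x y))"


text \<open>The maximum in \<open>alternation\<close> and the minimum in \<open>cc_xor\<close> are attained.\<close>

lemma finite_cube: "finite (cube n)"
  using finite_lists_length_eq[of "UNIV :: bool set" n] by (simp add: cube_def)

lemma computes_exists:
  assumes "finite X"
  shows "\<exists>P. computes X Y F P"
  using assms
proof (induction X rule: finite_induct)
  case empty
  then show ?case by (simp add: computes_def)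
next
  case (insert a X)
  then obtain P where "computes X Y F P" by blast
  then have "computes (insert a X) Y F
      (Alice (\<lambda>x. x = a) P (Bob (F a) (Output False) (Output True)))"
    by (auto simp: computes_def)
  then show ?case by blast
qed

lemma cc_xor_attained:
  "\<exists>P. computes (cube n) (cube n) (\<lambda>x y. f (bxor x y)) P \<and> cost P = cc_xor n f"
  unfolding cc_xor_def det_cc_def
  by (rule LeastI_ex) (use computes_exists[OF finite_cube] in blast)

lemma cube_chain_exists: "cube_chain n (\<lambda>i. replicate i True @ replicate (n - i) False)"
proof -
  have "inj_on (\<lambda>i. replicate i True @ replicate (n - i) False) {0..n}"
  proof (rule inj_onI)
    fix i j
    assume "replicate i True @ replicate (n - i) False = replicate j True @ replicate (n - j) False"
    then have "length (filter id (replicate i True @ replicate (n - i) False)) =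
        length (filter id (replicate j True @ replicate (n - j) False))" by simp
    then show "i = j" by simp
  qed
  then show ?thesis
    by (auto simp: cube_chain_def cube_def preceq_def list_all2_conv_all_nth nth_append)
qed

lemma alternation_attained:
  "\<exists>c. cube_chain n c \<and> card {i\<in>{1..n}. f (c (i - 1)) \<noteq> f (c i)} = alternation n f"
proof -
  let ?A = "{card {i\<in>{1..n}. f (c (i - 1)) \<noteq> f (c i)} | c. cube_chain n c}"
  have "card {i\<in>{1..n}. f (c (i - 1)) \<noteq> f (c i)} \<le> n" for c
    by (rule order_trans[OF card_mono[of "{1..n}"]]) auto
  then have "?A \<subseteq> {..n}" by auto
  then have "finite ?A" by (rule finite_subset) simp
  moreover have "?A \<noteq> {}" using cube_chain_exists by blast
  ultimately have "Max ?A \<in> ?A" by (rule Max_in)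
  then show ?thesis by (auto simp: alternation_def)
qed

end

theory Submission
  imports Defs "HOL-Real_Asymp.Real_Asymp"
begin

text \<open>
  Let \<open>d\<close> be the degree of \<open>f\<close> over \<open>F\<^sub>2\<close>, \<open>k\<close> its alternation and \<open>s\<close> its sparsity.
  A subcube of dimension \<open>d\<close> on which \<open>f\<close> has odd weight forces \<open>2 ^ d - 1\<close> nonzero Fourier
  coefficients, so \<open>d \<le> 1 + log s\<close>.  Starting at \<open>0\<close> and moving \<open>k\<close> times to a minimal point
  above where the value flips (each time at distance at most \<open>d\<close>) gives at most \<open>k d\<close> variables
  which, set to \<open>1\<close>, make \<open>f\<close> constant; these variables meet all monomials of top degree, so
  querying them lowers the degree whatever the answers.  Hence \<open>f\<close> has a decision tree of depth
  \<open>k d\<^sup>2\<close>, and the communication complexity is at most \<open>2 k d\<^sup>2\<close>.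
  Finally, the derivative in each relevant variable is a nonzero polynomial of degree at most \<open>d\<close>,
  so that variable is sensitive on a fraction \<open>2 ^ - d\<close> of the inputs; as the average sensitivity
  is at most the decision tree depth, \<open>n \<le> 2 ^ (d + 1) k d\<^sup>2\<close>.  With \<open>k\<close> polylogarithmic in \<open>n\<close>
  this yields \<open>log n \<le> 4 d\<close>, so \<open>k\<close> is polynomial in \<open>d\<close> as well.
\<close>

section \<open>Degree over the two-element field, via parities of weights on subcubes\<close>

definition subcube_weight :: "('a set \<Rightarrow> bool) \<Rightarrow> 'a set \<Rightarrow> 'a set \<Rightarrow> nat" where
  "subcube_weight F T z = card {y \<in> Pow T. F (z \<union> y)}"

text \<open>Degree over \<open>F\<^sub>2\<close> without polynomials: the coefficient of the monomial \<open>T\<close> in the restriction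
  of \<open>F\<close> to the subcube in directions \<open>T\<close> based at \<open>z\<close> is the parity of the weight of \<open>F\<close> there.\<close>

definition f2_degree_le :: "'a set \<Rightarrow> nat \<Rightarrow> ('a set \<Rightarrow> bool) \<Rightarrow> bool" where
  "f2_degree_le V d F \<longleftrightarrow>
     (\<forall>T z. T \<subseteq> V \<longrightarrow> z \<subseteq> V - T \<longrightarrow> d < card T \<longrightarrow> even (subcube_weight F T z))"

lemma subcube_weight_insert:
  assumes "finite T" "i \<notin> T"
  shows "subcube_weight F (insert i T) z = subcube_weight F T z + subcube_weight F T (insert i z)"
proof -
  have "{y \<in> Pow (insert i T). F (z \<union> y)} =
      {y \<in> Pow T. F (z \<union> y)} \<union> {y \<in> insert i ` Pow T. F (z \<union> y)}"
    unfolding Pow_insert by blast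
  also have "{y \<in> insert i ` Pow T. F (z \<union> y)} = insert i ` {y \<in> Pow T. F (insert i z \<union> y)}"
  proof (intro equalityI subsetI)
    fix y assume "y \<in> {y \<in> insert i ` Pow T. F (z \<union> y)}"
    then obtain u where "u \<subseteq> T" "y = insert i u" "F (z \<union> insert i u)" by auto
    then show "y \<in> insert i ` {y \<in> Pow T. F (insert i z \<union> y)}" by (intro image_eqI[of _ _ u]) simp_all
  qed (elim imageE, simp)
  finally have "{y \<in> Pow (insert i T). F (z \<union> y)} =
      {y \<in> Pow T. F (z \<union> y)} \<union> insert i ` {y \<in> Pow T. F (insert i z \<union> y)}" .
  moreover have "{y \<in> Pow T. F (z \<union> y)} \<inter> insert i ` {y \<in> Pow T. F (insert i z \<union> y)} = {}"
    using assms by auto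
  moreover have "inj_on (insert i) {y \<in> Pow T. F (insert i z \<union> y)}"
  proof (rule inj_onI)
    fix y y' assume "y \<in> {y \<in> Pow T. F (insert i z \<union> y)}" "y' \<in> {y \<in> Pow T. F (insert i z \<union> y)}"
    then have "i \<notin> y" "i \<notin> y'" using assms(2) by blast+
    then show "insert i y = insert i y' \<Longrightarrow> y = y'" by (simp add: insert_ident)
  qed
  ultimately show ?thesis
    using assms by (simp add: subcube_weight_def card_Un_disjoint card_image)
qed

lemma f2_degree_leD:
  assumes "f2_degree_le V d F" "T \<subseteq> V" "z \<subseteq> V - T" "d < card T"
  shows "even (subcube_weight F T z)"
  using assms unfolding f2_degree_le_def by blast

text \<open>Subcubes of the restriction are subcubes of the original cube, with base point
  \<open>B \<union> z\<close>.\<close>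

lemma f2_degree_le_restrict:
  assumes "f2_degree_le V d F" "B \<subseteq> A" "A \<subseteq> V"
  shows "f2_degree_le (V - A) d (\<lambda>x. F (B \<union> x))"
  unfolding f2_degree_le_def
proof (intro allI impI)
  fix T z assume *: "T \<subseteq> V - A" "z \<subseteq> V - A - T" "d < card T"
  have "even (subcube_weight F T (B \<union> z))"
    by (rule f2_degree_leD[OF assms(1)]) (use * assms in auto)
  then show "even (subcube_weight (\<lambda>x. F (B \<union> x)) T z)"
    by (simp add: subcube_weight_def Un_assoc)
qed

text \<open>Two parallel subcubes of dimension \<open>d\<close> that differ in one coordinate form a
  subcube of dimension \<open>d + 1\<close>, so their weights have the same parity.\<close>

lemma f2_degree_le_parity_base:
  assumes fin: "finite V" and deg: "f2_degree_le V (Suc d) F"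
    and T: "T \<subseteq> V" "d < card T" and z: "z \<subseteq> V - T"
  shows "even (subcube_weight F T z) \<longleftrightarrow> even (subcube_weight F T {})"
proof -
  have "finite z" using fin z by (meson finite_Diff finite_subset)
  then show ?thesis using z
  proof (induction z rule: finite_induct)
    case (insert i z)
    have "finite T" using fin T finite_subset by blast
    then have "even (subcube_weight F (insert i T) z)"
      using insert T by (intro f2_degree_leD[OF deg]) (auto simp: card_insert_if)
    moreover have "i \<notin> T" using insert by auto
    ultimately have "even (subcube_weight F T z) \<longleftrightarrow> even (subcube_weight F T (insert i z))"
      using \<open>finite T\<close> by (simp add: subcube_weight_insert)
    then show ?case using insert by auto
  qed simp
qed

lemma even_subcube_weight_const:
  assumes "finite T" "T \<noteq> {}" "\<And>y. y \<subseteq> T \<Longrightarrow> F (z \<union> y) = b"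
  shows "even (subcube_weight F T z)"
proof -
  have "{y \<in> Pow T. F (z \<union> y)} = (if b then Pow T else {})" using assms(3) by auto
  moreover have "card T > 0" using assms by (simp add: card_gt_0_iff)
  ultimately show ?thesis using assms(1) by (simp add: subcube_weight_def card_Pow)
qed

text \<open>A restriction of the variables in \<open>A\<close> that makes \<open>F\<close> constant meets every monomial of top
  degree, so every assignment to \<open>A\<close> lowers the degree.\<close>

lemma f2_degree_le_drop:
  assumes fin: "finite V" and deg: "f2_degree_le V (Suc d) F" and AV: "A \<subseteq> V"
    and const: "\<And>w. A \<subseteq> w \<Longrightarrow> w \<subseteq> V \<Longrightarrow> F w = F A" and BA: "B \<subseteq> A"
  shows "f2_degree_le (V - A) d (\<lambda>x. F (B \<union> x))"
  unfolding f2_degree_le_def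
proof (intro allI impI)
  fix T z assume *: "T \<subseteq> V - A" "z \<subseteq> V - A - T" "d < card T"
  note same = f2_degree_le_parity_base[OF fin deg _ *(3)]
  have TV: "T \<subseteq> V" and zV: "A \<subseteq> V - T" "B \<union> z \<subseteq> V - T"
    using * AV BA by blast+
  have "finite T" using fin TV finite_subset by blast
  moreover have "T \<noteq> {}" using *(3) by auto
  moreover have "F (A \<union> y) = F A" if "y \<subseteq> T" for y
    using const[of "A \<union> y"] that * AV by blast
  ultimately have "even (subcube_weight F T A)"
    by (rule even_subcube_weight_const[of T F A "F A"])
  then have "even (subcube_weight F T (B \<union> z))"
    using same[of A] same[of "B \<union> z"] TV zV by simp
  then show "even (subcube_weight (\<lambda>x. F (B \<union> x)) T z)"
    by (simp add: subcube_weight_def Un_assoc)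
qed

text \<open>Even weight on one-dimensional subcubes means that \<open>F\<close> agrees on the two
  ends of every edge.\<close>

lemma f2_degree_le_0_const:
  assumes "finite V" "f2_degree_le V 0 F" "z \<subseteq> V"
  shows "F z = F {}"
proof -
  have "finite z" using assms finite_subset by blast
  then show ?thesis using assms(3)
  proof (induction z rule: finite_induct)
    case (insert i z)
    have "even (subcube_weight F {i} z)"
      using insert by (intro f2_degree_leD[OF assms(2)]) auto
    moreover have "subcube_weight F {i} z = of_bool (F z) + of_bool (F (insert i z))"
      by (simp add: subcube_weight_insert) (simp add: subcube_weight_def conj_commute Collect_conv_if)
    ultimately have "F z = F (insert i z)" by (auto split: if_splits)
    then show ?case using insert by auto
  qed simp
qed

section \<open>Alternation along growing sets, and subcubes on which the function is
  constant\<close>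

text \<open>A form of alternation suited to induction: the steps of the chain may have any size and
  only the value flips are counted.\<close>

primrec alternates :: "('a set \<Rightarrow> bool) \<Rightarrow> 'a set \<Rightarrow> nat \<Rightarrow> 'a set \<Rightarrow> bool" where
  "alternates F V 0 z \<longleftrightarrow> True"
| "alternates F V (Suc k) z \<longleftrightarrow> (\<exists>w. z \<subseteq> w \<and> w \<subseteq> V \<and> F w \<noteq> F z \<and> alternates F V k w)"

lemma alternates_Suc_D: "alternates F V (Suc k) z \<Longrightarrow> alternates F V k z"
proof (induction k arbitrary: z)
  case (Suc k)
  then obtain w where "z \<subseteq> w" "w \<subseteq> V" "F w \<noteq> F z" "alternates F V (Suc k) w"
    unfolding alternates.simps(2)[of F V "Suc k"] by blast
  then show ?case using Suc.IH unfolding alternates.simps(2)[of F V k] by blast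
qed simp

text \<open>If \<open>F z = F w\<close>, the first flip seen from \<open>w\<close> also serves
  \<open>z\<close>. Otherwise \<open>w\<close> itself is the first flip, and the last one is given
  up.\<close>

lemma alternates_below:
  assumes "alternates F V k w" "z \<subseteq> w" "w \<subseteq> V"
  shows "alternates F V k z"
proof (cases k)
  case (Suc m)
  show ?thesis
  proof (cases "F z = F w")
    case True
    obtain u where "w \<subseteq> u" "u \<subseteq> V" "F u \<noteq> F w" "alternates F V m u"
      using assms(1) Suc by auto
    moreover from this have "z \<subseteq> u" "F u \<noteq> F z" using assms(2) True by simp_all
    ultimately show ?thesis unfolding Suc alternates.simps by blast
  next
    case False
    moreover have "alternates F V m w" using assms(1) Suc alternates_Suc_D by blast
    ultimately show ?thesis using assms(2,3) unfolding Suc alternates.simps by blast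
  qed
qed simp

lemma alternates_restrict:
  assumes "alternates (\<lambda>x. F (B \<union> x)) (V - A) k z" "B \<subseteq> A" "A \<subseteq> V"
  shows "alternates F V k (B \<union> z)"
  using assms(1)
proof (induction k arbitrary: z)
  case (Suc k)
  then obtain w where "z \<subseteq> w" "w \<subseteq> V - A" "F (B \<union> w) \<noteq> F (B \<union> z)"
    "alternates F V k (B \<union> w)" by auto
  then show ?case using assms(2,3) by (auto intro!: exI[of _ "B \<union> w"])
qed simp

text \<open>Induction on \<open>k\<close>: moving from \<open>z\<close> to a smallest flip point
  \<open>x\<close> above it uses up one alternation and adds at most \<open>d\<close> elements,
  because the subcube between \<open>z\<close> and \<open>x\<close> has odd weight.\<close>

lemma exists_constant_subcube:
  assumes "finite V" "f2_degree_le V d F" "z \<subseteq> V" "\<not> alternates F V (Suc k) z"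
  shows "\<exists>A. z \<subseteq> A \<and> A \<subseteq> V \<and> card (A - z) \<le> k * d \<and> (\<forall>w. A \<subseteq> w \<longrightarrow> w \<subseteq> V \<longrightarrow> F w = F A)"
  using assms(3,4)
proof (induction k arbitrary: z)
  case 0
  then have "\<forall>w. z \<subseteq> w \<longrightarrow> w \<subseteq> V \<longrightarrow> F w = F z"
    unfolding alternates.simps by blast
  moreover have "card (z - z) \<le> 0 * d" by simp
  ultimately show ?case using 0(1) by blast
next
  case (Suc k)
  show ?case
  proof (cases "\<exists>w. z \<subseteq> w \<and> w \<subseteq> V \<and> F w \<noteq> F z")
    case False
    then have "\<forall>w. z \<subseteq> w \<longrightarrow> w \<subseteq> V \<longrightarrow> F w = F z" by blast
    moreover have "card (z - z) \<le> Suc k * d" by simp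
    ultimately show ?thesis using Suc.prems(1) by blast
  next
    case True
    then obtain w where "z \<subseteq> w \<and> w \<subseteq> V \<and> F w \<noteq> F z" by (elim exE)
    \<comment> \<open>Least cardinality makes \<open>F\<close> equal to \<open>F z\<close> on the
      whole interval from \<open>z\<close> to \<open>x\<close>, except at \<open>x\<close>.\<close>
    from ex_has_least_nat[of "\<lambda>w. z \<subseteq> w \<and> w \<subseteq> V \<and> F w \<noteq> F z", OF this, of card]
    obtain x where x: "z \<subseteq> x" "x \<subseteq> V" "F x \<noteq> F z"
      and least: "\<And>y. z \<subseteq> y \<Longrightarrow> y \<subseteq> V \<Longrightarrow> F y \<noteq> F z \<Longrightarrow> card x \<le> card y"
      by metis
    define T where "T = x - z"
    have finx: "finite x" using x assms(1) finite_subset by blast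
    then have finT: "finite T" by (simp add: T_def)
    have below: "F (z \<union> y) = F z" if "y \<subset> T" for y
    proof (rule ccontr)
      assume "F (z \<union> y) \<noteq> F z"
      moreover have "z \<subseteq> z \<union> y" "z \<union> y \<subseteq> V" using that x(1,2) T_def by blast+
      ultimately have "card x \<le> card (z \<union> y)" using least[of "z \<union> y"] by blast
      moreover have "z \<union> y \<subset> x" using that x(1) T_def by blast
      then have "card (z \<union> y) < card x" using finx by (rule psubset_card_mono[rotated])
      ultimately show False by simp
    qed
    have TV: "T \<subseteq> V" "z \<subseteq> V - T" using x(2) Suc.prems(1) T_def by blast+
    have zT: "z \<union> T = x" using x(1) T_def by blast
    have "T \<noteq> {}" using x(3) zT by auto
    then have "card T > 0" using finT by (simp add: card_gt_0_iff)
    \<comment> \<open>The weight is \<open>1\<close> or \<open>2 ^ card T - 1\<close>, according to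
      the value at the top.\<close>
    have "odd (subcube_weight F T z)"
    proof (cases "F x")
      case True
      then have "F (z \<union> y) \<longleftrightarrow> y = T" if "y \<subseteq> T" for y
        using below[of y] x(3) zT that by (cases "y = T") auto
      then have "{y \<in> Pow T. F (z \<union> y)} = {T}" by blast
      then show ?thesis by (simp add: subcube_weight_def)
    next
      case False
      then have "F (z \<union> y) \<longleftrightarrow> y \<noteq> T" if "y \<subseteq> T" for y
        using below[of y] x(3) zT that by (cases "y = T") auto
      then have "{y \<in> Pow T. F (z \<union> y)} = Pow T - {T}" by blast
      then show ?thesis using finT \<open>card T > 0\<close>
        by (simp add: subcube_weight_def card_Pow card_Diff_singleton)
    qed
    then have "card T \<le> d"
      using f2_degree_leD[OF assms(2), of T z] TV not_le by blast
    have "\<not> alternates F V (Suc k) x"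
      using Suc.prems(2) x unfolding alternates.simps(2)[of F V "Suc k"] by blast
    from Suc.IH[OF x(2) this]
    obtain A where A: "x \<subseteq> A" "A \<subseteq> V" "card (A - x) \<le> k * d"
      "\<forall>w. A \<subseteq> w \<longrightarrow> w \<subseteq> V \<longrightarrow> F w = F A"
      by (elim exE conjE)
    have "A - z = T \<union> (A - x)" using A(1) x(1) T_def by blast
    then have "card (A - z) \<le> Suc k * d"
      using card_Un_le[of T "A - x"] A(3) \<open>card T \<le> d\<close> by simp
    then show ?thesis using A x(1) by (intro exI[of _ A]) blast
  qed
qed

section \<open>Decision trees: construction from degree and alternation, and sensitivity\<close>

text \<open>Decision tree depth at most \<open>k\<close>.\<close>

inductive decidable_in :: "nat \<Rightarrow> ('a set \<Rightarrow> bool) \<Rightarrow> bool" where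
  leaf: "decidable_in k (\<lambda>x. b)"
| query: "decidable_in k (\<lambda>x. F (insert i x)) \<Longrightarrow> decidable_in k (\<lambda>x. F (x - {i})) \<Longrightarrow>
    decidable_in (Suc k) F"

lemma decidable_in_mono:
  "decidable_in k F \<Longrightarrow> k \<le> l \<Longrightarrow> decidable_in l F"
proof (induction k F arbitrary: l rule: decidable_in.induct)
  case (query k F i)
  then obtain l' where "l = Suc l'" "k \<le> l'" by (cases l) auto
  then show ?case using query by (auto intro: decidable_in.query)
qed (rule leaf)

text \<open>The elements of \<open>A\<close> are queried one by one; \<open>B\<close> collects those
  found in \<open>x\<close>, and \<open>x - A\<close> is what remains unknown.\<close>

lemma decidable_in_query_set:
  assumes "finite A" "\<And>B. B \<subseteq> A \<Longrightarrow> decidable_in k (\<lambda>x. F (B \<union> (x - A)))"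
  shows "decidable_in (card A + k) F"
  using assms
proof (induction A arbitrary: F rule: finite_induct)
  case empty
  then show ?case by simp
next
  case (insert i A)
  have "decidable_in (card A + k) (\<lambda>x. F (insert i x))"
  proof (rule insert.IH)
    fix B assume "B \<subseteq> A"
    moreover have "insert i (B \<union> (x - A)) = insert i B \<union> (x - insert i A)" for x by auto
    ultimately show "decidable_in k (\<lambda>x. F (insert i (B \<union> (x - A))))"
      using insert.prems[of "insert i B"] by auto
  qed
  moreover have "decidable_in (card A + k) (\<lambda>x. F (x - {i}))"
  proof (rule insert.IH)
    fix B assume "B \<subseteq> A"
    moreover from this have "B \<union> (x - A) - {i} = B \<union> (x - insert i A)" for x
      using insert.hyps by auto
    ultimately show "decidable_in k (\<lambda>x. F (B \<union> (x - A) - {i}))"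
      using insert.prems[of B] by auto
  qed
  ultimately show ?case using insert.hyps by (simp add: decidable_in.query)
qed

text \<open>Each round queries a set \<open>A\<close> above which \<open>F\<close> is constant.
  Every answer \<open>B\<close> lowers the degree by one and keeps the bound on the alternation, so
  \<open>d\<close> rounds suffice. The intersection with \<open>V\<close> is there because trees act
  on arbitrary sets.\<close>

lemma decidable_in_alternation_degree:
  assumes "finite V" "f2_degree_le V d F" "\<not> alternates F V (Suc k) {}"
  shows "decidable_in (k * d * d) (\<lambda>x. F (x \<inter> V))"
  using assms
proof (induction d arbitrary: V F)
  case 0
  then have "(\<lambda>x. F (x \<inter> V)) = (\<lambda>x. F {})"
    using f2_degree_le_0_const[of V F] by (intro ext) blast
  then show ?case by (simp add: leaf)
next
  case (Suc d)
  obtain A where A: "A \<subseteq> V" "card A \<le> k * Suc d" and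
    const: "\<And>w. A \<subseteq> w \<Longrightarrow> w \<subseteq> V \<Longrightarrow> F w = F A"
    using exists_constant_subcube[OF Suc.prems(1,2) _ Suc.prems(3)] by (metis Diff_empty empty_subsetI)
  have "decidable_in (card A + k * d * d) (\<lambda>x. F (x \<inter> V))"
  proof (rule decidable_in_query_set)
    show "finite A" using A Suc.prems finite_subset by blast
  next
    fix B assume B: "B \<subseteq> A"
    \<comment> \<open>Starting at \<open>B\<close> instead of \<open>{}\<close> cannot produce more
      flips, and flips of the restriction are flips of \<open>F\<close> above
      \<open>B\<close>.\<close>
    have "\<not> alternates F V (Suc k) (B \<union> {})"
      using alternates_below[of F V "Suc k" "B \<union> {}" "{}"] Suc.prems(3) A(1) B
      by (metis Un_empty_right empty_subsetI subset_trans)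
    then have "\<not> alternates (\<lambda>x. F (B \<union> x)) (V - A) (Suc k) {}"
      using alternates_restrict[OF _ B A(1)] by metis
    then have "decidable_in (k * d * d) (\<lambda>x. F (B \<union> (x \<inter> (V - A))))"
      using Suc.prems(1) f2_degree_le_drop[OF Suc.prems(1,2) A(1) const B] by (intro Suc.IH) simp_all
    moreover have "(B \<union> (x - A)) \<inter> V = B \<union> (x \<inter> (V - A))" for x using A B by auto
    ultimately show "decidable_in (k * d * d) (\<lambda>x. F ((B \<union> (x - A)) \<inter> V))" by simp
  qed
  moreover have "card A + k * d * d \<le> k * Suc d * Suc d" using A(2) by (simp add: algebra_simps)
  ultimately show ?case by (rule decidable_in_mono)
qed

text \<open>Only variables queried on the path of \<open>x\<close> can change the value. Counting
  just the \<open>i\<close> outside \<open>x\<close> records each sensitive edge once, at its lower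
  end.\<close>

lemma sensitivity_le_decidable_in:
  assumes "decidable_in k F"
  shows "finite {i. i \<notin> x \<and> F (insert i x) \<noteq> F x} \<and> card {i. i \<notin> x \<and> F (insert i x) \<noteq> F x} \<le> k"
  using assms
proof (induction k F rule: decidable_in.induct)
  case (query k F j)
  define G where "G = (if j \<in> x then (\<lambda>x. F (insert j x)) else (\<lambda>x. F (x - {j})))"
  let ?S = "\<lambda>F. {i. i \<notin> x \<and> F (insert i x) \<noteq> F x}"
  have "F (insert i x) = G (insert i x)" if "i \<noteq> j" for i
    using that by (auto simp: G_def insert_absorb)
  moreover have "F x = G x" by (auto simp: G_def insert_absorb)
  ultimately have "?S F \<subseteq> insert j (?S G)" by blast
  moreover have "finite (?S G)" "card (?S G) \<le> k" using query.IH by (auto simp: G_def)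
  ultimately have "finite (?S F)" "card (?S F) \<le> card (insert j (?S G))"
    by (simp_all add: finite_subset card_mono)
  moreover have "card (insert j (?S G)) \<le> Suc k"
    using \<open>finite (?S G)\<close> \<open>card (?S G) \<le> k\<close> by (simp add: card_insert_if)
  ultimately show ?case by simp
qed simp

section \<open>Density of nonzero low-degree functions, and the bound on the number of
  variables\<close>

text \<open>The minimum distance of Reed-Muller codes. Split along \<open>i\<close>: if both halves
  are nonzero, the bounds add up; if one half vanishes, the other one equals the derivative along
  \<open>i\<close>, whose degree is smaller by one.\<close>

lemma nonzero_f2_degree_le_weight:
  assumes "finite V" "f2_degree_le V d F" "x \<subseteq> V" "F x"
  shows "2 ^ card V \<le> 2 ^ d * card {y \<in> Pow V. F y}"
  using assms
proof (induction V arbitrary: d F x rule: finite_induct)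
  case empty
  then have "{y \<in> Pow {}. F y} = {{}}" by auto
  then show ?case by simp
next
  case (insert i V)
  let ?F1 = "\<lambda>y. F (insert i y)"
  have halves: "card {y \<in> Pow (insert i V). F y} = card {y \<in> Pow V. F y} + card {y \<in> Pow V. ?F1 y}"
    using subcube_weight_insert[OF insert.hyps, of F "{}"] by (simp add: subcube_weight_def)
  have deg0: "f2_degree_le V d F" and deg1: "f2_degree_le V d ?F1"
    using f2_degree_le_restrict[OF insert.prems(1), of "{}" "{i}"]
      f2_degree_le_restrict[OF insert.prems(1), of "{i}" "{i}"] insert.hyps by auto
  \<comment> \<open>The derivative along \<open>i\<close> has degree below \<open>d\<close>: adding
    the direction \<open>i\<close> to \<open>T\<close> gives a subcube of dimension above
    \<open>d\<close>.\<close>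
  have par: "even (subcube_weight F T z + subcube_weight ?F1 T z)"
    if "T \<subseteq> V" "z \<subseteq> V - T" "d < Suc (card T)" for T z
  proof -
    have "finite T" "i \<notin> T" using that insert.hyps finite_subset by auto
    moreover have "even (subcube_weight F (insert i T) z)"
      by (rule f2_degree_leD[OF insert.prems(1)])
        (use that insert.hyps \<open>finite T\<close> \<open>i \<notin> T\<close> in auto)
    ultimately show ?thesis
      using subcube_weight_insert[of T i F z] by (simp add: subcube_weight_def)
  qed
  \<comment> \<open>The case of one vanishing half \<open>H'\<close>, stated so that either half can
    take that place.\<close>
  have half: "2 ^ card (insert i V) \<le> 2 ^ d * card {y \<in> Pow V. H y}"
    if degH: "f2_degree_le V d H" and H: "w \<subseteq> V" "H w" and zero: "\<And>y. y \<subseteq> V \<Longrightarrow> \<not> H' y"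
      and par: "\<And>T z. T \<subseteq> V \<Longrightarrow> z \<subseteq> V - T \<Longrightarrow> d < Suc (card T) \<Longrightarrow>
        even (subcube_weight H T z + subcube_weight H' T z)" for H H' w
  proof -
    have par': "even (subcube_weight H T z)" if "T \<subseteq> V" "z \<subseteq> V - T" "d < Suc (card T)" for T z
    proof -
      have "{y \<in> Pow T. H' (z \<union> y)} = {}" using zero that by blast
      then have "subcube_weight H' T z = 0" unfolding subcube_weight_def by (metis card.empty)
      then show ?thesis using par[OF that] by simp
    qed
    \<comment> \<open>For \<open>d = 0\<close> the choice \<open>T = {}\<close> is allowed, but the
      single point \<open>w\<close> has weight \<open>1\<close>.\<close>
    have "d \<noteq> 0"
    proof
      assume "d = 0"
      then have "even (subcube_weight H {} w)" using par'[of "{}" w] H by auto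
      then show False using H by (simp add: subcube_weight_def Collect_conv_if)
    qed
    then obtain e where e: "d = Suc e" by (cases d) auto
    then have "f2_degree_le V e H" using par' by (auto simp: f2_degree_le_def)
    then have "2 ^ card V \<le> 2 ^ e * card {y \<in> Pow V. H y}" using insert.IH H by blast
    then show ?thesis using e insert.hyps by simp
  qed
  show ?case
  proof (cases "\<exists>y\<subseteq>V. F y")
    case True
    then obtain y where y: "y \<subseteq> V" "F y" by auto
    show ?thesis
    proof (cases "\<exists>y\<subseteq>V. ?F1 y")
      case True
      then obtain y' where y': "y' \<subseteq> V" "?F1 y'" by auto
      show ?thesis
        using insert.IH[OF deg0 y] insert.IH[OF deg1 y'] insert.hyps
        unfolding halves distrib_left by simp
    next
      case False
      then have "2 ^ card (insert i V) \<le> 2 ^ d * card {y \<in> Pow V. F y}"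
        using half[OF deg0 y, of ?F1] par by blast
      also have "\<dots> \<le> 2 ^ d * card {y \<in> Pow (insert i V). F y}" by (simp add: halves del: Pow_iff)
      finally show ?thesis .
    qed
  next
    case False
    then have "\<not> x \<subseteq> V" using insert.prems(3) by blast
    then have "i \<in> x" using insert.prems(2) by blast
    then have "x - {i} \<subseteq> V" "?F1 (x - {i})"
      using insert.prems(2,3) by (blast, simp add: insert_absorb)
    moreover have "even (subcube_weight ?F1 T z + subcube_weight F T z)"
      if "T \<subseteq> V" "z \<subseteq> V - T" "d < Suc (card T)" for T z
      using par[OF that] by (simp add: add.commute)
    ultimately have "2 ^ card (insert i V) \<le> 2 ^ d * card {y \<in> Pow V. ?F1 y}"
      using half[OF deg1, of "x - {i}" F] False by blast
    also have "\<dots> \<le> 2 ^ d * card {y \<in> Pow (insert i V). F y}" by (simp add: halves del: Pow_iff)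
    finally show ?thesis .
  qed
qed

text \<open>The exclusive or has, modulo 2, the sum of the two weights, which is the weight on the
  directions \<open>insert i T\<close>.\<close>

lemma f2_degree_le_derivative:
  assumes "finite V" "f2_degree_le V d F" "i \<in> V"
  shows "f2_degree_le (V - {i}) d (\<lambda>x. F (insert i x) \<noteq> F x)"
  unfolding f2_degree_le_def
proof (intro allI impI)
  fix T z assume *: "T \<subseteq> V - {i}" "z \<subseteq> V - {i} - T" "d < card T"
  have fT: "finite T" "i \<notin> T" using * assms(1) by (auto intro: finite_subset)
  let ?A = "{y \<in> Pow T. F (z \<union> y)}" and ?B = "{y \<in> Pow T. F (insert i z \<union> y)}"
  have "even (subcube_weight F (insert i T) z)"
    by (rule f2_degree_leD[OF assms(2)]) (use * assms fT in auto)
  then have "even (card ?A + card ?B)"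
    using subcube_weight_insert[OF fT] by (simp add: subcube_weight_def)
  moreover have "subcube_weight (\<lambda>x. F (insert i x) \<noteq> F x) T z = card ((?A - ?B) \<union> (?B - ?A))"
    unfolding subcube_weight_def by (rule arg_cong[of _ _ card]) auto
  moreover have "card ((?A - ?B) \<union> (?B - ?A)) = card (?A - ?B) + card (?B - ?A)"
    using fT by (intro card_Un_disjoint) auto
  moreover have "card ?A = card (?A - ?B) + card (?A \<inter> ?B)"
    "card ?B = card (?B - ?A) + card (?A \<inter> ?B)"
    using fT by (simp_all add: card_Diff_subset_Int Int_commute card_mono)
  ultimately show "even (subcube_weight (\<lambda>x. F (insert i x) \<noteq> F x) T z)"
    by presburger
qed

text \<open>Double counting of the sensitive edges: each direction carries at least
  \<open>2 ^ (card V - 1) / 2 ^ d\<close> of them, and each point is the lower end of at most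
  \<open>D\<close>.\<close>

lemma card_variables_le:
  assumes "finite V" "f2_degree_le V d F" "decidable_in D (\<lambda>x. F (x \<inter> V))"
    and dep: "\<And>i. i \<in> V \<Longrightarrow> \<exists>x \<subseteq> V - {i}. F (insert i x) \<noteq> F x"
  shows "card V \<le> 2 ^ Suc d * D"
proof (cases "V = {}")
  case False
  let ?N = "\<lambda>i. {x \<in> Pow (V - {i}). F (insert i x) \<noteq> F x}"
  have "2 ^ (card V - 1) \<le> 2 ^ d * card (?N i)" if "i \<in> V" for i
  proof -
    from dep[OF that] obtain x where "x \<subseteq> V - {i}" "F (insert i x) \<noteq> F x" by (elim exE conjE)
    then show ?thesis
      using nonzero_f2_degree_le_weight[OF _ f2_degree_le_derivative[OF assms(1,2) that]] assms(1) that
      by (simp add: card_Diff_singleton)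
  qed
  then have "card V * 2 ^ (card V - 1) \<le> (\<Sum>i\<in>V. 2 ^ d * card (?N i))"
    using sum_mono[of V "\<lambda>_. 2 ^ (card V - 1)" "\<lambda>i. 2 ^ d * card (?N i)"] by simp
  also have "\<dots> = 2 ^ d * (\<Sum>i\<in>V. card (?N i))" by (simp add: sum_distrib_left)
  also have "(\<Sum>i\<in>V. card (?N i)) = card (SIGMA i:V. ?N i)"
    using assms(1) by (subst card_SigmaI) auto
  also have "\<dots> = card (SIGMA x:Pow V. {i \<in> V. i \<notin> x \<and> F (insert i x) \<noteq> F x})"
    by (rule bij_betw_same_card[of prod.swap]) (auto simp: bij_betw_def inj_on_def image_iff)
  also have "\<dots> = (\<Sum>x\<in>Pow V. card {i \<in> V. i \<notin> x \<and> F (insert i x) \<noteq> F x})"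
    using assms(1) by (subst card_SigmaI) auto
  also have "\<dots> \<le> (\<Sum>x\<in>Pow V. D)"
  proof (rule sum_mono)
    fix x assume "x \<in> Pow V"
    then have "{i \<in> V. i \<notin> x \<and> F (insert i x) \<noteq> F x}
        \<subseteq> {i. i \<notin> x \<and> F (insert i x \<inter> V) \<noteq> F (x \<inter> V)}"
      by (auto simp: Int_absorb2)
    then show "card {i \<in> V. i \<notin> x \<and> F (insert i x) \<noteq> F x} \<le> D"
      using sensitivity_le_decidable_in[OF assms(3), of x] card_mono le_trans by blast
  qed
  \<comment> \<open>For nonempty \<open>V\<close>, this exposes the power that cancels on both sides
    and leaves the extra factor \<open>2\<close> of \<open>2 ^ Suc d\<close>.\<close>
  also have "\<dots> = 2 * 2 ^ (card V - 1) * D"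
    using False assms(1) by (simp add: card_Pow power_eq_if)
  finally show ?thesis by simp
qed simp

section \<open>Protocols from decision trees\<close>

text \<open>The tree is run on the symmetric difference of \<open>g x\<close> and
  \<open>h y\<close>; each query costs two bits, one from each player.\<close>

lemma protocol_of_decidable_in:
  assumes "decidable_in k F"
  shows "\<exists>P. cost P \<le> 2 * k \<and> (\<forall>x y. run P x y = F {i. i \<in> g x \<longleftrightarrow> i \<notin> h y})"
  using assms
proof (induction k F rule: decidable_in.induct)
  case (leaf k b)
  then show ?case by (intro exI[of _ "Output b"]) simp
next
  case (query k F i)
  let ?D = "\<lambda>x y. {i. i \<in> g x \<longleftrightarrow> i \<notin> h y}"
  obtain P where P: "cost P \<le> 2 * k" "\<And>x y. run P x y = F (insert i (?D x y))"
    using query.IH by auto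
  obtain Q where Q: "cost Q \<le> 2 * k" "\<And>x y. run Q x y = F (?D x y - {i})"
    using query.IH by auto
  let ?P = "Alice (\<lambda>x. i \<in> g x) (Bob (\<lambda>y. i \<in> h y) Q P) (Bob (\<lambda>y. i \<in> h y) P Q)"
  have "run ?P x y = F (?D x y)" for x y
    by (cases "i \<in> ?D x y") (auto simp: P Q insert_absorb)
  moreover have "cost ?P \<le> 2 * Suc k" using P Q by simp
  ultimately show ?case by blast
qed

section \<open>Comparison with maximal chains of bit lists, and transfer of the notions to
  sets\<close>

text \<open>An ordering of the coordinates encodes a maximal chain, and this counts the flips along
  it.\<close>

primrec changes :: "('a set \<Rightarrow> bool) \<Rightarrow> 'a set \<Rightarrow> 'a list \<Rightarrow> nat" where
  "changes F z [] = 0"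
| "changes F z (i # xs) = of_bool (F z \<noteq> F (insert i z)) + changes F (insert i z) xs"

lemma changes_append: "changes F z (xs @ ys) = changes F z xs + changes F (z \<union> set xs) ys"
  by (induction xs arbitrary: z) simp_all

lemma changes_pos: "F (z \<union> set xs) \<noteq> F z \<Longrightarrow> 1 \<le> changes F z xs"
proof (induction xs arbitrary: z)
  case (Cons i xs)
  then show ?case by (cases "F z = F (insert i z)") auto
qed simp

lemma changes_eq_sum:
  "changes F z xs = (\<Sum>j<length xs. of_bool (F (z \<union> set (take j xs)) \<noteq> F (z \<union> set (take (Suc j) xs))))"
  by (induction xs arbitrary: z) (simp_all add: sum.lessThan_Suc_shift del: sum.lessThan_Suc)

text \<open>Each jump from \<open>z\<close> to \<open>w\<close> is refined into single insertions,
  at least one of which must flip the value.\<close>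

lemma alternates_imp_changes:
  assumes "finite V" "z \<subseteq> V" "alternates F V k z"
  shows "\<exists>xs. distinct xs \<and> set xs = V - z \<and> k \<le> changes F z xs"
  using assms(2,3)
proof (induction k arbitrary: z)
  case 0
  have "finite (V - z)" using assms(1) by simp
  then show ?case using finite_distinct_list[of "V - z"] by auto
next
  case (Suc k)
  from Suc.prems(2) obtain w where w: "z \<subseteq> w" "w \<subseteq> V" "F w \<noteq> F z" "alternates F V k w"
    unfolding alternates.simps by (elim exE conjE)
  from Suc.IH[OF w(2,4)] obtain ys where ys: "distinct ys" "set ys = V - w" "k \<le> changes F w ys"
    by (elim exE conjE)
  have "finite (w - z)" using assms(1) w(2) finite_subset by blast
  then obtain xs where xs: "set xs = w - z" "distinct xs" using finite_distinct_list by blast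
  have zw: "z \<union> set xs = w" using xs(1) w(1) by blast
  then have "Suc k \<le> changes F z (xs @ ys)"
    using changes_pos[of F z xs] w(3) ys(3) by (simp add: changes_append)
  moreover have "distinct (xs @ ys)" "set (xs @ ys) = V - z" using xs ys w(1,2) by auto
  ultimately show ?case by blast
qed

text \<open>Bit lists are replaced by their sets of true positions; elements of \<open>X\<close>
  from \<open>n\<close> on have no effect.\<close>

definition on_sets :: "nat \<Rightarrow> (bool list \<Rightarrow> bool) \<Rightarrow> nat set \<Rightarrow> bool" where
  "on_sets n f X = f (map (\<lambda>i. i \<in> X) [0..<n])"

lemma changes_le_alternation:
  assumes "distinct xs" "set xs = {..<n}"
  shows "changes (on_sets n f) {} xs \<le> alternation n f"
proof -
  define c where "c j = map (\<lambda>i. i \<in> set (take j xs)) [0..<n]" for j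
  have len: "length xs = n" using assms distinct_card[of xs] by simp
  have inj: "inj_on c {0..n}"
  proof (rule inj_onI)
    fix j k assume jk: "j \<in> {0..n}" "k \<in> {0..n}" "c j = c k"
    have sub: "set (take l xs) \<subseteq> {..<n}" for l using assms(2) set_take_subset by fastforce
    have "i \<in> set (take j xs) \<longleftrightarrow> i \<in> set (take k xs)" if "i < n" for i
      using arg_cong[OF jk(3), of "\<lambda>x. x ! i"] that by (simp add: c_def)
    then have "set (take j xs) = set (take k xs)" using sub[of j] sub[of k] by blast
    then have "card (set (take j xs)) = card (set (take k xs))" by simp
    then show "j = k" using assms(1) jk len by (simp add: distinct_card)
  qed
  have "preceq (c (j - 1)) (c j)" for j
    using set_take_subset_set_take[of "j - 1" j xs]
    by (auto simp: c_def preceq_def list_all2_conv_all_nth)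
  then have "cube_chain n c"
    using inj len assms(2)
    by (auto simp: cube_chain_def cube_def c_def list_eq_iff_nth_eq)
  moreover have "changes (on_sets n f) {} xs = card {i \<in> {1..n}. f (c (i - 1)) \<noteq> f (c i)}"
    using sum.atLeast1_atMost_eq[of "\<lambda>i. of_bool (f (c (i - 1)) \<noteq> f (c i)) :: nat" n]
    by (simp add: changes_eq_sum len on_sets_def c_def[symmetric] sum_of_bool_eq Int_def)
  moreover have "finite {card {i \<in> {1..n}. f (c (i - 1)) \<noteq> f (c i)} | c. cube_chain n c}"
  proof (rule finite_subset)
    have "card {i \<in> {1..n}. P i} \<le> n" for P
      by (rule order_trans[OF card_mono[of "{1..n}"]]) auto
    then show "{card {i \<in> {1..n}. f (c (i - 1)) \<noteq> f (c i)} | c. cube_chain n c} \<subseteq> {..n}" by auto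
  qed simp
  ultimately show ?thesis unfolding alternation_def by (auto intro!: Max_ge)
qed

lemma not_alternates_alternation:
  "\<not> alternates (on_sets n f) {..<n} (Suc (alternation n f)) {}"
proof
  assume "alternates (on_sets n f) {..<n} (Suc (alternation n f)) {}"
  from alternates_imp_changes[OF _ _ this] obtain xs where
    "distinct xs" "set xs = {..<n}" "Suc (alternation n f) \<le> changes (on_sets n f) {} xs" by auto
  then show False using changes_le_alternation[of xs n f] by simp
qed

lemma cc_xor_le_decidable_in:
  assumes "decidable_in D (\<lambda>x. on_sets n f (x \<inter> {..<n}))"
  shows "cc_xor n f \<le> 2 * D"
proof -
  let ?g = "\<lambda>x. {i. i < n \<and> x ! i}"
  obtain P where P: "cost P \<le> 2 * D"
    "\<And>x y. run P x y = on_sets n f ({i. i \<in> ?g x \<longleftrightarrow> i \<notin> ?g y} \<inter> {..<n})"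
    using protocol_of_decidable_in[OF assms, of ?g ?g] by blast
  have "map (\<lambda>i. i \<in> {i. i \<in> ?g x \<longleftrightarrow> i \<notin> ?g y} \<inter> {..<n}) [0..<n] = bxor x y"
    if "length x = n" "length y = n" for x y
    using that by (auto simp: bxor_def list_eq_iff_nth_eq)
  then have "computes (cube n) (cube n) (\<lambda>x y. f (bxor x y)) P"
    unfolding computes_def cube_def P on_sets_def by simp
  then have "cc_xor n f \<le> cost P"
    unfolding cc_xor_def det_cc_def by (intro Least_le) blast
  then show ?thesis using P(1) by simp
qed

lemma depends_on_all_on_sets:
  assumes "depends_on_all n f" "i < n"
  shows "\<exists>X \<subseteq> {..<n} - {i}. on_sets n f (insert i X) \<noteq> on_sets n f X"
proof -
  obtain x where x: "length x = n" "f (x[i := \<not> x ! i]) \<noteq> f x"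
    using assms by (auto simp: depends_on_all_def cube_def)
  let ?X = "{j. j < n \<and> j \<noteq> i \<and> x ! j}"
  have "map (\<lambda>j. j \<in> ?X) [0..<n] = x[i := False]"
    "map (\<lambda>j. j \<in> insert i ?X) [0..<n] = x[i := True]"
    using x(1) assms(2) by (auto intro!: nth_equalityI simp: nth_list_update split: if_splits)
  then have "on_sets n f ?X = f (x[i := False])" "on_sets n f (insert i ?X) = f (x[i := True])"
    unfolding on_sets_def by simp_all
  moreover have "x[i := x ! i] = x" by simp
  then have "f (x[i := True]) \<noteq> f (x[i := False])" using x(2) by (cases "x ! i") auto
  ultimately have "on_sets n f (insert i ?X) \<noteq> on_sets n f ?X" by simp
  moreover have "?X \<subseteq> {..<n} - {i}" by auto
  ultimately show ?thesis by blast
qed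

section \<open>Fourier analysis on sets and the lower bound on sparsity\<close>

text \<open>For finite \<open>S\<close> this is the character
  \<open>(- 1) ^ card (S \<inter> X)\<close>; as a product it factorises in sums over power
  sets.\<close>

definition sign :: "'a set \<Rightarrow> 'a set \<Rightarrow> real" where
  "sign S X = (\<Prod>i\<in>S. if i \<in> X then - 1 else 1)"

lemma sign_commute:
  assumes "finite S" "finite X"
  shows "sign S X = sign X S"
proof -
  have "sign S X = (\<Prod>i\<in>S \<inter> X. - 1)" "sign X S = (\<Prod>i\<in>X \<inter> S. - 1)"
    unfolding sign_def using assms by (simp_all only: prod.inter_restrict)
  then show ?thesis by (simp only: Int_commute)
qed

lemma sign_cases: "sign S X = 1 \<or> sign S X = - 1"
  unfolding sign_def by (induction S rule: infinite_finite_induct) auto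

text \<open>Orthogonality of characters: the sum factorises over \<open>M\<close>, with factor
  \<open>2\<close> where \<open>x\<close> and \<open>y\<close> agree and \<open>0\<close> where they
  differ.\<close>

lemma sum_Pow_sign:
  assumes "finite M"
  shows "(\<Sum>R\<in>Pow M. sign R x * sign R y) =
    (if x \<inter> M = y \<inter> M then 2 ^ card M else 0)"
proof -
  let ?e = "\<lambda>i. (if i \<in> x then - 1 else 1) * (if i \<in> y then - 1 else (1 :: real))"
  have "(\<Sum>R\<in>Pow M. sign R x * sign R y) = (\<Sum>R\<in>Pow M. (\<Prod>i\<in>R. ?e i) * (\<Prod>i\<in>M - R. 1))"
    by (simp add: sign_def prod.distrib)
  also have "\<dots> = (\<Prod>i\<in>M. ?e i + 1)" using prod_add[OF assms, of ?e "\<lambda>_. 1"] by simp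
  also have "\<dots> = (if x \<inter> M = y \<inter> M then 2 ^ card M else 0)"
  proof (cases "x \<inter> M = y \<inter> M")
    case True
    then have "(\<Prod>i\<in>M. ?e i + 1) = (\<Prod>i\<in>M. 2)" by (intro prod.cong) auto
    then show ?thesis using True by simp
  next
    case False
    then obtain i where "i \<in> M" "i \<in> x \<longleftrightarrow> i \<notin> y" by blast
    then have "(\<Prod>i\<in>M. ?e i + 1) = 0" using assms by (intro prod_zero) (auto intro!: bexI[of _ i])
    then show ?thesis using False by simp
  qed
  finally show ?thesis .
qed

text \<open>The Fourier coefficients of the restriction of \<open>G\<close> to a subcube in directions \<open>T\<close> are signed
  sums of Fourier coefficients of \<open>G\<close>.\<close>

lemma restricted_fourier_zero:
  assumes "finite N" "T \<subseteq> N" "z \<subseteq> N - T" "S \<subseteq> T"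
    and zero: "\<And>R. R \<subseteq> N - T \<Longrightarrow> (\<Sum>X\<in>Pow N. G X * sign (S \<union> R) X) = 0"
  shows "(\<Sum>y\<in>Pow T. G (z \<union> y) * sign S y) = 0"
proof -
  let ?M = "N - T"
  have fin: "finite S" "finite T" "finite ?M" using assms by (auto intro: finite_subset)
  \<comment> \<open>Weighting with \<open>sign R z\<close> and summing over \<open>R\<close> leaves,
    by orthogonality, only the \<open>X\<close> that agree with \<open>z\<close> outside
    \<open>T\<close>.\<close>
  have "0 = (\<Sum>R\<in>Pow ?M. sign R z * (\<Sum>X\<in>Pow N. G X * sign (S \<union> R) X))"
    using zero by simp
  also have "\<dots> = (\<Sum>R\<in>Pow ?M. \<Sum>X\<in>Pow N. G X * sign S X * (sign R X * sign R z))"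
  proof (rule sum.cong[OF refl])
    fix R assume "R \<in> Pow ?M"
    then have "finite R" "S \<inter> R = {}" using fin assms(4) by (auto intro: finite_subset)
    then have "sign (S \<union> R) X = sign S X * sign R X" for X
      unfolding sign_def using fin(1) by (simp add: prod.union_disjoint)
    then show "sign R z * (\<Sum>X\<in>Pow N. G X * sign (S \<union> R) X) =
        (\<Sum>X\<in>Pow N. G X * sign S X * (sign R X * sign R z))"
      by (simp add: sum_distrib_left mult_ac)
  qed
  also have "\<dots> = (\<Sum>X\<in>Pow N. G X * sign S X * (\<Sum>R\<in>Pow ?M. sign R X * sign R z))"
    by (subst sum.swap) (simp add: sum_distrib_left)
  also have "\<dots> = (\<Sum>X\<in>Pow N. if X - T = z then G X * sign S X * 2 ^ card ?M else 0)"
  proof (rule sum.cong[OF refl])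
    fix X assume "X \<in> Pow N"
    then have "X \<inter> ?M = z \<inter> ?M \<longleftrightarrow> X - T = z" using assms(3) by blast
    then show "G X * sign S X * (\<Sum>R\<in>Pow ?M. sign R X * sign R z) =
        (if X - T = z then G X * sign S X * 2 ^ card ?M else 0)"
      using fin(3) by (simp add: sum_Pow_sign)
  qed
  also have "\<dots> = (\<Sum>X | X \<in> Pow N \<and> X - T = z. G X * sign S X * 2 ^ card ?M)"
    using assms(1) by (simp add: sum.inter_filter[symmetric] del: Pow_iff)
  also have "{X. X \<in> Pow N \<and> X - T = z} = (\<union>) z ` Pow T"
  proof (intro equalityI subsetI)
    fix X assume "X \<in> {X. X \<in> Pow N \<and> X - T = z}"
    then have "X = z \<union> (X \<inter> T)" by blast
    then show "X \<in> (\<union>) z ` Pow T" by blast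
  qed (use assms(2,3) in auto)
  also have "(\<Sum>X\<in>(\<union>) z ` Pow T. G X * sign S X * 2 ^ card ?M) =
      (\<Sum>y\<in>Pow T. G (z \<union> y) * sign S (z \<union> y) * 2 ^ card ?M)"
  proof (subst sum.reindex)
    show "inj_on ((\<union>) z) (Pow T)" using assms(3) by (intro inj_onI) blast
  qed simp
  also have "\<dots> = (\<Sum>y\<in>Pow T. G (z \<union> y) * sign S y) * 2 ^ card ?M"
  proof -
    have "sign S (z \<union> y) = sign S y" for y
      unfolding sign_def using assms(3,4) by (intro prod.cong) auto
    then show ?thesis by (simp add: sum_distrib_right)
  qed
  finally show ?thesis by simp
qed

text \<open>The sum is \<open>card A\<close> minus twice the number of negative signs, hence an odd
  integer.\<close>

lemma odd_sum_signs_nonzero: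
  fixes e :: "'a \<Rightarrow> real"
  assumes "odd (card A)" "\<And>y. y \<in> A \<Longrightarrow> e y = 1 \<or> e y = - 1"
  shows "(\<Sum>y\<in>A. e y) \<noteq> 0"
proof
  assume sum0: "(\<Sum>y\<in>A. e y) = 0"
  have "finite A" using assms(1) card.infinite by fastforce
  have "(\<Sum>y\<in>A. e y) = (\<Sum>y\<in>A. 1 - 2 * of_bool (e y = - 1))"
    using assms(2) by (intro sum.cong) auto
  also have "\<dots> = real (card A) - 2 * real (card (A \<inter> {y. e y = - 1}))"
    using \<open>finite A\<close> by (simp add: sum_subtractf sum_of_bool_eq flip: sum_distrib_left)
  finally have "real (card A) = real (2 * card (A \<inter> {y. e y = - 1}))" using sum0 by simp
  then have "card A = 2 * card (A \<inter> {y. e y = - 1})" by (simp only: of_nat_eq_iff)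
  then show False using assms(1) by simp
qed

lemma fourier_coeff_on_sets:
  assumes "S \<subseteq> {..<n}"
  shows "fourier_coeff n (\<lambda>x. 1 - 2 * of_bool (f x)) S =
    (\<Sum>X\<in>Pow {..<n}. (1 - 2 * of_bool (on_sets n f X)) * sign S X) / 2 ^ n"
proof -
  let ?l = "\<lambda>X. map (\<lambda>i. i \<in> X) [0..<n]"
  have "bij_betw ?l (Pow {..<n}) (cube n)"
    by (rule bij_betw_byWitness[where f' = "\<lambda>x. {i. i < n \<and> x ! i}"])
      (auto simp: cube_def list_eq_iff_nth_eq)
  moreover have "character S (?l X) = sign S X" for X
  proof -
    have "character S (?l X) = (\<Prod>i\<in>S. (- 1) ^ of_bool (?l X ! i))"
      by (simp add: character_def power_sum)
    also have "\<dots> = sign S X" unfolding sign_def using assms by (intro prod.cong) auto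
    finally show ?thesis .
  qed
  ultimately show ?thesis
    unfolding fourier_coeff_def
    by (subst sum.reindex_bij_betw[of ?l "Pow {..<n}", symmetric]) (simp_all add: on_sets_def)
qed

text \<open>On the odd subcube every coefficient at a nonempty \<open>S \<subseteq> T\<close> is
  nonzero, so some \<open>S \<union> R\<close> with \<open>R\<close> outside \<open>T\<close> lies
  in the support; distinct \<open>S\<close> give distinct elements.\<close>

lemma sparsity_ge_odd_subcube:
  assumes T: "T \<subseteq> {..<n}" and z: "z \<subseteq> {..<n} - T"
    and odd: "odd (subcube_weight (on_sets n f) T z)"
  shows "2 ^ card T - 1 \<le> sparsity n f"
proof -
  define supp where
    "supp = {S. S \<subseteq> {..<n} \<and> fourier_coeff n (\<lambda>x. 1 - 2 * of_bool (f x)) S \<noteq> 0}"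
  let ?G = "\<lambda>X. 1 - 2 * of_bool (on_sets n f X) :: real"
  have finT: "finite T" using T finite_subset by blast
  have "Pow T - {{}} \<subseteq> (\<lambda>S. S \<inter> T) ` supp"
  proof
    fix S assume S: "S \<in> Pow T - {{}}"
    then have finS: "finite S" using finT finite_subset by blast
    \<comment> \<open>Read as orthogonality of the points \<open>S\<close> and \<open>{}\<close>,
      the sum vanishes for nonempty \<open>S\<close>; hence the empty set is left out.\<close>
    have "(\<Sum>y\<in>Pow T. sign S y) = (\<Sum>y\<in>Pow T. sign y S * sign y {})"
    proof (rule sum.cong[OF refl])
      fix y assume "y \<in> Pow T"
      then have "finite y" using finT finite_subset by blast
      then show "sign S y = sign y S * sign y {}"
        by (simp add: sign_commute[OF finS] sign_def[of y "{}"])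
    qed
    also have "\<dots> = 0" using S finT by (subst sum_Pow_sign) auto
    finally have "(\<Sum>y\<in>Pow T. ?G (z \<union> y) * sign S y) =
        - 2 * (\<Sum>y\<in>Pow T. of_bool (on_sets n f (z \<union> y)) * sign S y)"
      by (simp add: left_diff_distrib sum_subtractf sum_distrib_left mult.assoc sum_negf)
    also have "(\<Sum>y\<in>Pow T. of_bool (on_sets n f (z \<union> y)) * sign S y) =
        (\<Sum>y\<in>{y \<in> Pow T. on_sets n f (z \<union> y)}. sign S y)"
      using finT by (simp only: sum.inter_filter finite_Pow_iff) (intro sum.cong, auto)
    finally have "(\<Sum>y\<in>Pow T. ?G (z \<union> y) * sign S y) \<noteq> 0"
      using odd_sum_signs_nonzero[OF odd[unfolded subcube_weight_def] sign_cases] by simp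
    then obtain R where R: "R \<subseteq> {..<n} - T" "(\<Sum>X\<in>Pow {..<n}. ?G X * sign (S \<union> R) X) \<noteq> 0"
      using restricted_fourier_zero[of "{..<n}" T z S ?G] T z S by blast
    have "S \<union> R \<subseteq> {..<n}" using S R T by blast
    then have "S \<union> R \<in> supp" using R(2) by (simp add: supp_def fourier_coeff_on_sets)
    moreover have "(S \<union> R) \<inter> T = S" using S R by blast
    ultimately show "S \<in> (\<lambda>S. S \<inter> T) ` supp" by blast
  qed
  moreover have "finite supp" unfolding supp_def by simp
  ultimately have "card (Pow T - {{}}) \<le> card supp" by (rule surj_card_le[rotated])
  then show ?thesis using finT by (simp add: supp_def sparsity_def card_Pow card_Diff_singleton)
qed

section \<open>Combination of the bounds\<close>

lemma complexity_bounds: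
  assumes dep: "depends_on_all n f" and "n > 0"
  obtains d where "d \<ge> 1" "2 ^ d - 1 \<le> sparsity n f"
    "cc_xor n f \<le> 2 * (alternation n f * d * d)"
    "n \<le> 2 ^ Suc d * (alternation n f * d * d)"
proof -
  let ?F = "on_sets n f" and ?V = "{..<n}"
  have dep': "\<exists>x \<subseteq> ?V - {i}. ?F (insert i x) \<noteq> ?F x" if "i \<in> ?V" for i
    using depends_on_all_on_sets[OF dep] that by simp
  have "card T \<le> n" if "T \<subseteq> ?V" for T using card_mono[OF _ that] by simp
  then have ex: "f2_degree_le ?V n ?F" by (auto simp: f2_degree_le_def not_less[symmetric])
  define d where "d = (LEAST d. f2_degree_le ?V d ?F)"
  have deg: "f2_degree_le ?V d ?F" unfolding d_def using ex by (rule LeastI)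
  have "d \<noteq> 0"
  proof
    assume "d = 0"
    then have const: "?F z = ?F {}" if "z \<subseteq> ?V" for z
      using f2_degree_le_0_const[of ?V ?F z] deg that by simp
    from dep'[of 0] obtain x where "x \<subseteq> ?V - {0}" "?F (insert 0 x) \<noteq> ?F x"
      using \<open>n > 0\<close> by auto
    then show False using const[of x] const[of "insert 0 x"] \<open>n > 0\<close> by auto
  qed
  \<comment> \<open>Since \<open>d\<close> is the least degree bound, some subcube of dimension at
    least \<open>d\<close> has odd weight.\<close>
  then have "\<not> f2_degree_le ?V (d - 1) ?F" 
    using not_less_Least[of "d - 1" "\<lambda>d. f2_degree_le ?V d ?F"] d_def by simp
  then obtain T z where T: "T \<subseteq> ?V" "z \<subseteq> ?V - T" "d - 1 < card T" "odd (subcube_weight ?F T z)"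
    unfolding f2_degree_le_def by blast
  have "(2 :: nat) ^ d \<le> 2 ^ card T" using T(3) \<open>d \<noteq> 0\<close> by (intro power_increasing) auto
  then have "2 ^ d - 1 \<le> sparsity n f" 
    using sparsity_ge_odd_subcube[OF T(1,2,4)] by linarith
  moreover have tree: "decidable_in (alternation n f * d * d) (\<lambda>x. ?F (x \<inter> ?V))"
    using decidable_in_alternation_degree[OF _ deg not_alternates_alternation] by simp
  moreover have "n \<le> 2 ^ Suc d * (alternation n f * d * d)"
    using card_variables_le[OF _ deg tree dep'] by simp
  ultimately show ?thesis using that[of d] \<open>d \<noteq> 0\<close> cc_xor_le_decidable_in[OF tree] by simp
qed

theorem theorem3:
  fixes c :: real
  assumes "c > 0"
  shows "\<exists>C d :: real. \<exists>n0 :: nat. C > 0 \<and> d > 0 \<and>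
    (\<forall>n\<ge>n0. \<forall>f :: bool list \<Rightarrow> bool.
       depends_on_all n f \<and> real (alternation n f) \<le> (log 2 (real n)) powr c \<longrightarrow>
       real (cc_xor n f) \<le> C * (1 + log 2 (real (sparsity n f))) powr d)"
proof -
  \<comment> \<open>This growth fact rules out \<open>log 2 n > 4 * d\<close>, which would give
    \<open>2 ^ d \<le> n powr (1 / 4)\<close>. The factor \<open>2\<close> stems from
    \<open>2 ^ Suc d\<close>, the exponent \<open>c + 2\<close> from the alternation times
    \<open>d * d\<close>.\<close>
  have "eventually (\<lambda>n :: nat. 2 * real n powr (1 / 4) * log 2 (real n) powr (c + 2) < real n) at_top"
    by real_asymp
  moreover have "eventually (\<lambda>n :: nat. 2 \<le> n) at_top" by (rule eventually_ge_at_top)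
  ultimately have "eventually (\<lambda>n :: nat. 2 \<le> n \<and>
      2 * real n powr (1 / 4) * log 2 (real n) powr (c + 2) < real n) at_top"
    by eventually_elim simp
  then obtain n0 :: nat where n0: "\<And>n. n \<ge> n0 \<Longrightarrow> 2 \<le> n"
    "\<And>n. n \<ge> n0 \<Longrightarrow> 2 * real n powr (1 / 4) * log 2 (real n) powr (c + 2) < real n"
    unfolding eventually_at_top_linorder by blast
  have bound: "real (cc_xor n f) \<le> 2 * 4 powr c * (1 + log 2 (real (sparsity n f))) powr (c + 2)"
    if "n \<ge> n0" and dep: "depends_on_all n f"
      and alt: "real (alternation n f) \<le> (log 2 (real n)) powr c" for n f
  proof -
    have "n \<ge> 2" using n0 \<open>n \<ge> n0\<close> by blast
    let ?L = "log 2 (real n)" and ?a = "alternation n f"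
    have "?L > 0" using \<open>n \<ge> 2\<close> by simp
    from \<open>n \<ge> 2\<close> have "n > 0" by simp
    from complexity_bounds[OF dep this] obtain d where d: "d \<ge> 1" "2 ^ d - 1 \<le> sparsity n f"
      "cc_xor n f \<le> 2 * (?a * d * d)" "n \<le> 2 ^ Suc d * (?a * d * d)" .
    have L: "?L \<le> 4 * real d"
    proof (rule ccontr)
      assume "\<not> ?L \<le> 4 * real d"
      then have "real d \<le> ?L / 4" "real d \<le> ?L" by simp_all
      have "2 ^ d = 2 powr real d" by (simp add: powr_realpow)
      also have "\<dots> \<le> 2 powr (?L * (1 / 4))" using \<open>real d \<le> ?L / 4\<close> by simp
      also have "\<dots> = real n powr (1 / 4)" using \<open>n > 0\<close> by (simp only: powr_powr[symmetric]) simp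
      finally have e: "(2 :: real) ^ d \<le> real n powr (1 / 4)" .
      have "real d * real d \<le> ?L * ?L" using \<open>real d \<le> ?L\<close> by (intro mult_mono) simp_all
      then have "real d * real d \<le> ?L powr 2" using \<open>?L > 0\<close> by (simp add: powr_numeral power2_eq_square)
      then have dd: "real ?a * (real d * real d) \<le> ?L powr c * ?L powr 2"
        using alt by (intro mult_mono) simp_all
      have "real n \<le> real (2 ^ Suc d * (?a * d * d))" using d(4) by (simp only: of_nat_le_iff)
      also have "\<dots> = 2 * (2 ^ d * (real ?a * (real d * real d)))" by simp
      also have "\<dots> \<le> 2 * (real n powr (1 / 4) * (?L powr c * ?L powr 2))"
        using mult_mono[OF e dd] by (intro mult_left_mono) simp_all
      also have "\<dots> = 2 * real n powr (1 / 4) * ?L powr (c + 2)" by (simp add: powr_add)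
      finally show False using n0(2)[OF \<open>n \<ge> n0\<close>] by simp
    qed
    \<comment> \<open>A pure power of two below the sparsity has logarithm \<open>d - 1\<close>;
      this is the source of the summand \<open>1\<close> in the bound on \<open>d\<close>.\<close>
    have "(2 :: nat) ^ (d - 1) \<le> 2 ^ d - 1" using d(1) by (cases d) simp_all
    then have "2 ^ (d - 1) \<le> real (sparsity n f)"
      using d(2) by (metis le_trans of_nat_le_iff of_nat_numeral of_nat_power)
    then have "log 2 (2 ^ (d - 1)) \<le> log 2 (real (sparsity n f))"
      by (intro log_mono) simp_all
    then have ds: "real d \<le> 1 + log 2 (real (sparsity n f))" using d(1) by (simp add: log_nat_power of_nat_diff)
    have "?L powr c \<le> (4 * real d) powr c" using L \<open>?L > 0\<close> assms by (intro powr_mono2) simp_all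
    then have a: "real ?a \<le> 4 powr c * real d powr c" using alt by (simp add: powr_mult)
    have "real (cc_xor n f) \<le> real (2 * (?a * d * d))" using d(3) by (simp only: of_nat_le_iff)
    also have "\<dots> = 2 * (real ?a * real d powr 2)" using d(1) by (simp add: powr_numeral power2_eq_square)
    also have "\<dots> \<le> 2 * (4 powr c * real d powr c * real d powr 2)"
      using a by (intro mult_left_mono mult_right_mono) simp_all
    also have "\<dots> = 2 * 4 powr c * real d powr (c + 2)" by (simp add: powr_add)
    also have "\<dots> \<le> 2 * 4 powr c * (1 + log 2 (real (sparsity n f))) powr (c + 2)"
      using ds assms by (intro mult_left_mono powr_mono2) simp_all
    finally show ?thesis .
  qed
  show ?thesis
    by (rule exI[of _ "2 * 4 powr c"], rule exI[of _ "c + 2"], rule exI[of _ n0])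
      (use bound assms in auto)
qed

end
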